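(* Let $R$ be a commutative ring with identity, $S$ a multiplicative subset of $R$, and $M$ an $R$-module. Then the following assertions are equivalent: (1) $M$ is $u$-$S$-Noetherian; (2) there exists an element $s\in S$ such that any ascending chain of submodules of $M$ is stationary with respect to $s$; (3) there exists an element $s\in S$ such that any non-empty set of submodules of $M$ has a maximal element with respect to $s$.
   Context: A subset $S$ of $R$ is multiplicative if $1\in S$ and $s_1s_2\in S$ for all $s_1,s_2\in S$. An $R$-module $M$ is $u$-$S$-Noetherian if there exists $s\in S$ such that for every submodule $N$ of $M$ there is a finitely generated submodule $F\subseteq N$ with $sN\subseteq F$. An ascending chain $M_1\subseteq M_2\subseteq\cdots$ of submodules of $M$ is stationary with respect to $s$ if there exists $k\ge 1$ such that $sM_n\subseteq M_k$ for all $n\ge k$. Given a family $\{M_i\}_{i\in\Lambda}$ of submodules of $M$, a member $M_0$ of the family is maximal with respect to $s$ if, whenever $M_0\subseteq M_i$ for some member $M_i$ of the family, one has $sM_i\subseteq M_0$. *)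

theory Defs
  imports "HOL-Algebra.Module" "HOL.Hull"
begin

text \<open>
  A multiplicative subset of \<open>R\<close> is a submonoid of the multiplicative monoid of \<open>R\<close>,
  that is \<open>submonoid S R\<close>.
\<close>

definition scaled_set :: "('a, 'b, 'd) module_scheme \<Rightarrow> 'a \<Rightarrow> 'b set \<Rightarrow> 'b set" where
  "scaled_set M s N = (\<lambda>x. s \<odot>\<^bsub>M\<^esub> x) ` N"

definition fin_gen_submodule ::
  "('a, 'c) ring_scheme \<Rightarrow> ('a, 'b, 'd) module_scheme \<Rightarrow> 'b set \<Rightarrow> bool" where
  "fin_gen_submodule R M F \<longleftrightarrow> submodule F R M \<and>
     (\<exists>A. finite A \<and> A \<subseteq> carrier M \<and> F = (\<lambda>N. submodule N R M) hull A)"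

definition u_S_Noetherian ::
  "('a, 'c) ring_scheme \<Rightarrow> 'a set \<Rightarrow> ('a, 'b, 'd) module_scheme \<Rightarrow> bool" where
  "u_S_Noetherian R S M \<longleftrightarrow>
     (\<exists>s\<in>S. \<forall>N. submodule N R M \<longrightarrow>
        (\<exists>F. fin_gen_submodule R M F \<and> F \<subseteq> N \<and> scaled_set M s N \<subseteq> F))"

text \<open>Chains are indexed by the positive integers; the value at \<open>0\<close> plays no role.\<close>

definition ascending_submodule_chain ::
  "('a, 'c) ring_scheme \<Rightarrow> ('a, 'b, 'd) module_scheme \<Rightarrow> (nat \<Rightarrow> 'b set) \<Rightarrow> bool" where
  "ascending_submodule_chain R M C \<longleftrightarrow>
     (\<forall>n\<ge>1. submodule (C n) R M \<and> C n \<subseteq> C (Suc n))"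

definition stationary_wrt ::
  "('a, 'b, 'd) module_scheme \<Rightarrow> 'a \<Rightarrow> (nat \<Rightarrow> 'b set) \<Rightarrow> bool" where
  "stationary_wrt M s C \<longleftrightarrow> (\<exists>k\<ge>1. \<forall>n\<ge>k. scaled_set M s (C n) \<subseteq> C k)"

definition maximal_wrt ::
  "('a, 'b, 'd) module_scheme \<Rightarrow> 'a \<Rightarrow> 'b set set \<Rightarrow> 'b set \<Rightarrow> bool" where
  "maximal_wrt M s \<F> M0 \<longleftrightarrow>
     M0 \<in> \<F> \<and> (\<forall>N\<in>\<F>. M0 \<subseteq> N \<longrightarrow> scaled_set M s N \<subseteq> M0)"

end

theory Submission
  imports Defs
begin

text \<open>
  The same \<open>s\<close> serves all three conditions. If \<open>N\<close> is the union of a chain, the generators of a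
  finitely generated \<open>F\<close> with \<open>s N \<subseteq> F \<subseteq> N\<close> already lie in one term of the chain. A family
  without an \<open>s\<close>-maximal member contains a chain with \<open>s C\<^sub>n\<^sub>+\<^sub>1\<close> never inside \<open>C\<^sub>n\<close>. Finally, if \<open>F\<close> is
  \<open>s\<close>-maximal among the finitely generated submodules of \<open>N\<close>, comparing \<open>F\<close> with \<open>F + R x\<close> for
  \<open>x \<in> N\<close> gives \<open>s x \<in> F\<close>.
\<close>

context module
begin

lemma submodule_zero_mem:
  assumes "submodule H R M"
  shows "\<zero>\<^bsub>M\<^esub> \<in> H"
  using subgroup.one_closed[OF submodule.axioms(1)[OF assms]] by simp

text \<open>Nonemptiness keeps the intersection inside the carrier: the empty intersection is the
  whole type.\<close>

lemma submodule_Inter: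
  assumes ne: "\<A> \<noteq> {}" and sub: "\<And>N. N \<in> \<A> \<Longrightarrow> submodule N R M"
  shows "submodule (\<Inter>\<A>) R M"
proof (rule submoduleI)
  show "\<Inter>\<A> \<subseteq> carrier M"
    using ne submoduleE(1)[OF sub] by blast
  show "\<zero>\<^bsub>M\<^esub> \<in> \<Inter>\<A>"
    using submodule_zero_mem[OF sub] by blast
  show "\<ominus>\<^bsub>M\<^esub> x \<in> \<Inter>\<A>" if "x \<in> \<Inter>\<A>" for x
    using that submoduleE(3)[OF sub] by blast
  show "x \<oplus>\<^bsub>M\<^esub> y \<in> \<Inter>\<A>" if "x \<in> \<Inter>\<A>" "y \<in> \<Inter>\<A>" for x y
    using that submoduleE(5)[OF sub] by blast
  show "a \<odot>\<^bsub>M\<^esub> x \<in> \<Inter>\<A>" if "a \<in> carrier R" "x \<in> \<Inter>\<A>" for a x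
    using that submoduleE(4)[OF sub] by blast
qed

text \<open>Only addition involves two terms of the chain at once; monotonicity brings both summands
  into the term with the larger index.\<close>

lemma submodule_Union_mono:
  assumes inc: "mono (C :: nat \<Rightarrow> _)" and sub: "\<And>n. submodule (C n) R M"
  shows "submodule (\<Union>n. C n) R M"
proof (rule submoduleI)
  show "(\<Union>n. C n) \<subseteq> carrier M"
    using submoduleE(1)[OF sub] by blast
  show "\<zero>\<^bsub>M\<^esub> \<in> (\<Union>n. C n)"
    using submodule_zero_mem[OF sub] by blast
  show "\<ominus>\<^bsub>M\<^esub> x \<in> (\<Union>n. C n)" if "x \<in> (\<Union>n. C n)" for x
    using that submoduleE(3)[OF sub] by blast
  show "x \<oplus>\<^bsub>M\<^esub> y \<in> (\<Union>n. C n)" if xy: "x \<in> (\<Union>n. C n)" "y \<in> (\<Union>n. C n)" for x y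
  proof -
    obtain m n where "x \<in> C m" "y \<in> C n" using xy by blast
    then have "x \<in> C (max m n)" "y \<in> C (max m n)"
      using monoD[OF inc, of m "max m n"] monoD[OF inc, of n "max m n"] by auto
    then show ?thesis
      using submoduleE(5)[OF sub] by blast
  qed
  show "a \<odot>\<^bsub>M\<^esub> x \<in> (\<Union>n. C n)" if "a \<in> carrier R" "x \<in> (\<Union>n. C n)" for a x
    using that submoduleE(4)[OF sub] by blast
qed

lemma submodule_hull:
  assumes "A \<subseteq> carrier M"
  shows "submodule ((\<lambda>N. submodule N R M) hull A) R M"
  \<comment> \<open>The carrier is a submodule containing \<open>A\<close>, so the family being
    intersected is nonempty.\<close>
  unfolding hull_def using assms carrier_is_submodule by (intro submodule_Inter) auto

lemma fin_gen_submodule_hull: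
  assumes "finite A" "A \<subseteq> carrier M"
  shows "fin_gen_submodule R M ((\<lambda>N. submodule N R M) hull A)"
  using assms submodule_hull unfolding fin_gen_submodule_def by blast

lemma stationary_if_noetherian:
  assumes noeth: "\<And>N. submodule N R M \<Longrightarrow>
      \<exists>F. fin_gen_submodule R M F \<and> F \<subseteq> N \<and> scaled_set M s N \<subseteq> F"
    and chain: "ascending_submodule_chain R M C"
  shows "stationary_wrt M s C"
proof -
  \<comment> \<open>Nothing is known about \<open>C 0\<close>; the shift gives a sequence that is
    increasing from index 0 on.\<close>
  define D where "D n = C (Suc n)" for n
  have inc: "mono D" and sub: "submodule (D n) R M" for n
    using chain unfolding mono_iff_le_Suc by (simp_all add: D_def ascending_submodule_chain_def)
  obtain F where F: "fin_gen_submodule R M F" "F \<subseteq> (\<Union>n. D n)" "scaled_set M s (\<Union>n. D n) \<subseteq> F"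
    using noeth[OF submodule_Union_mono[OF inc sub]] by blast
  then obtain A where A: "finite A" "F = (\<lambda>N. submodule N R M) hull A"
    unfolding fin_gen_submodule_def by blast
  then have "A \<subseteq> (\<Union>n. D n)"
    using F(2) hull_subset[of A] by blast
  \<comment> \<open>A finite set covered by the union of a chain of sets lies in one member; as that
    member is a submodule, it then contains all of \<open>F\<close>.\<close>
  moreover have "subset.chain UNIV (range D)"
    unfolding subset_chain_def using monoD[OF inc] nat_le_linear by blast
  ultimately obtain k where "A \<subseteq> D k"
    using finite_subset_Union_chain[OF A(1), of "range D" UNIV] by blast
  then have "F \<subseteq> D k"
    unfolding A(2) by (intro hull_minimal sub)
  \<comment> \<open>\<open>D k\<close> is \<open>C (Suc k)\<close>, and the index
    \<open>Suc k\<close> also meets the requirement of being at least 1.\<close>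
  have "scaled_set M s (C n) \<subseteq> C (Suc k)" if "n \<ge> Suc k" for n
  proof -
    have "C n \<subseteq> (\<Union>n. D n)"
      using that by (cases n) (auto simp: D_def)
    then have "scaled_set M s (C n) \<subseteq> scaled_set M s (\<Union>n. D n)"
      unfolding scaled_set_def by (rule image_mono)
    with F(3) \<open>F \<subseteq> D k\<close> show ?thesis
      unfolding D_def by blast
  qed
  then show ?thesis
    unfolding stationary_wrt_def by (intro exI[of _ "Suc k"]) simp
qed

lemma maximal_if_stationary:
  assumes stat: "\<And>C. ascending_submodule_chain R M C \<Longrightarrow> stationary_wrt M s C"
    and "\<F> \<noteq> {}" and sub: "\<And>N. N \<in> \<F> \<Longrightarrow> submodule N R M"
  shows "\<exists>M0. maximal_wrt M s \<F> M0"
proof (rule ccontr)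
  assume "\<nexists>M0. maximal_wrt M s \<F> M0"
  then have "\<exists>N'. N' \<in> \<F> \<and> N \<subseteq> N' \<and> \<not> scaled_set M s N' \<subseteq> N" if "N \<in> \<F>" for N
    using that unfolding maximal_wrt_def by blast
  \<comment> \<open>Dependent choice, started at any member of the nonempty family.\<close>
  then obtain C where C: "\<And>n::nat. C n \<in> \<F>"
      "\<And>n. C n \<subseteq> C (Suc n) \<and> \<not> scaled_set M s (C (Suc n)) \<subseteq> C n"
    using \<open>\<F> \<noteq> {}\<close>
      dependent_nat_choice[of "\<lambda>_ N. N \<in> \<F>" "\<lambda>_ N N'. N \<subseteq> N' \<and> \<not> scaled_set M s N' \<subseteq> N"]
    by (metis ex_in_conv)
  then have "stationary_wrt M s C"
    using sub by (intro stat) (auto simp: ascending_submodule_chain_def)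
  \<comment> \<open>An index \<open>k\<close> witnessing stationarity already fails at
    \<open>n = Suc k\<close>.\<close>
  then show False
    using C(2) unfolding stationary_wrt_def by (meson le_Suc_eq order_refl)
qed

lemma noetherian_if_maximal:
  assumes max: "\<And>\<F>. \<F> \<noteq> {} \<Longrightarrow> (\<And>N. N \<in> \<F> \<Longrightarrow> submodule N R M) \<Longrightarrow> \<exists>M0. maximal_wrt M s \<F> M0"
    and N: "submodule N R M"
  shows "\<exists>F. fin_gen_submodule R M F \<and> F \<subseteq> N \<and> scaled_set M s N \<subseteq> F"
proof -
  let ?span = "\<lambda>A. (\<lambda>N. submodule N R M) hull A"
  define \<F> where "\<F> = {F. fin_gen_submodule R M F \<and> F \<subseteq> N}"
  have span: "?span A \<in> \<F>" if "finite A" "A \<subseteq> N" for A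
    using that fin_gen_submodule_hull[of A] submoduleE(1)[OF N] hull_minimal[of A N "\<lambda>N. submodule N R M"] N
    unfolding \<F>_def by auto
  \<comment> \<open>The span of the empty set is a member.\<close>
  have "\<F> \<noteq> {}"
    using span[of "{}"] by auto
  moreover have "submodule F R M" if "F \<in> \<F>" for F
    using that by (simp add: \<F>_def fin_gen_submodule_def)
  ultimately obtain F where F: "maximal_wrt M s \<F> F"
    using max[of \<F>] by blast
  then have "F \<in> \<F>"
    by (simp add: maximal_wrt_def)
  then obtain A where A: "finite A" "F = ?span A" and FN: "fin_gen_submodule R M F" "F \<subseteq> N"
    unfolding \<F>_def fin_gen_submodule_def by auto
  have "s \<odot>\<^bsub>M\<^esub> x \<in> F" if "x \<in> N" for x
  proof -
    have "A \<subseteq> N"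
      using A(2) FN(2) hull_subset[of A] by blast
    \<comment> \<open>This span is F + R x, written through generators so that finite generation is
      immediate.\<close>
    then have "?span (insert x A) \<in> \<F>"
      using A(1) that by (intro span) auto
    moreover have "F \<subseteq> ?span (insert x A)"
      unfolding A(2) by (rule hull_mono) blast
    ultimately have "scaled_set M s (?span (insert x A)) \<subseteq> F"
      using F unfolding maximal_wrt_def by blast
    moreover have "x \<in> ?span (insert x A)"
      by (rule hull_inc) simp
    ultimately show ?thesis
      unfolding scaled_set_def by blast
  qed
  then show ?thesis
    using FN unfolding scaled_set_def by blast
qed

end

theorem theorem2p7:
  fixes R :: "('a, 'c) ring_scheme"
    and M :: "('a, 'b, 'd) module_scheme"
    and S :: "'a set"
  assumes "cring R"
    and "submonoid S R"
    and "module R M"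
  shows "(u_S_Noetherian R S M \<longleftrightarrow>
            (\<exists>s\<in>S. \<forall>C. ascending_submodule_chain R M C \<longrightarrow> stationary_wrt M s C))
       \<and> ((\<exists>s\<in>S. \<forall>C. ascending_submodule_chain R M C \<longrightarrow> stationary_wrt M s C) \<longleftrightarrow>
            (\<exists>s\<in>S. \<forall>\<F>. \<F> \<noteq> {} \<and> (\<forall>N\<in>\<F>. submodule N R M) \<longrightarrow> (\<exists>M0. maximal_wrt M s \<F> M0)))"
proof -
  interpret module R M by fact
  let ?noeth = "\<lambda>s. \<forall>N. submodule N R M \<longrightarrow>
    (\<exists>F. fin_gen_submodule R M F \<and> F \<subseteq> N \<and> scaled_set M s N \<subseteq> F)"
  let ?stat = "\<lambda>s. \<forall>C. ascending_submodule_chain R M C \<longrightarrow> stationary_wrt M s C"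
  let ?max = "\<lambda>s. \<forall>\<F>. \<F> \<noteq> {} \<and> (\<forall>N\<in>\<F>. submodule N R M) \<longrightarrow> (\<exists>M0. maximal_wrt M s \<F> M0)"
  have 12: "?stat s" if "?noeth s" for s
    using that stationary_if_noetherian[of s] by simp
  have 23: "?max s" if "?stat s" for s
    using that maximal_if_stationary[of s] by simp
  have 31: "?noeth s" if max: "?max s" for s
  proof (intro allI impI)
    fix N
    assume N: "submodule N R M"
    show "\<exists>F. fin_gen_submodule R M F \<and> F \<subseteq> N \<and> scaled_set M s N \<subseteq> F"
      by (rule noetherian_if_maximal[OF _ N]) (use max in simp)
  qed
  \<comment> \<open>The cycle of implications closes for each fixed \<open>s\<close>, so the
    equivalences pass under the quantifier over \<open>S\<close>.\<close>
  have "?noeth s \<longleftrightarrow> ?stat s" for s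
    by (rule iffI[OF 12 31[OF 23]])
  moreover have "?stat s \<longleftrightarrow> ?max s" for s
    by (rule iffI[OF 23 12[OF 31]])
  ultimately show ?thesis
    unfolding u_S_Noetherian_def by simp
qed

end
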